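(* Let $p$ be a prime. For any integer $r \ge 1$, there exists a group $G$ of order $p^{(r+1)(r+2)/2}$ such that $|P(G)| = 1$; moreover, $\Pr_g(G) = (p^2-1)/p^{2r+1}$ for each $1 \neq g \in K(G)$, and if $r > 1$, then $G$ is not a Camina group.
   Context: For a finite group $G$ and $g \in G$, $\Pr_g(G) = |\{(x,y)\in G\times G \mid x^{-1}y^{-1}xy = g\}|/|G|^2$. $K(G)=\{[x,y] = x^{-1}y^{-1}xy \mid x,y\in G\}$ is the set of all commutators, and $P(G) = \{\Pr_g(G) \mid 1\neq g\in K(G)\}$. $\gamma_2(G)$ is the commutator subgroup and $x^G$ the conjugacy class of $x$. A finite group $G$ is a Camina group if $x^G = x\gamma_2(G)$ for all $x \in G - \gamma_2(G)$. *)

theory Defs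
  imports "HOL-Algebra.Generated_Groups" "HOL-Computational_Algebra.Primes" Complex_Main
begin

definition commutator :: "('a, 'b) monoid_scheme \<Rightarrow> 'a \<Rightarrow> 'a \<Rightarrow> 'a" where
  "commutator G x y = inv\<^bsub>G\<^esub> x \<otimes>\<^bsub>G\<^esub> inv\<^bsub>G\<^esub> y \<otimes>\<^bsub>G\<^esub> x \<otimes>\<^bsub>G\<^esub> y"

definition commutator_set :: "('a, 'b) monoid_scheme \<Rightarrow> 'a set" where
  "commutator_set G = {commutator G x y | x y. x \<in> carrier G \<and> y \<in> carrier G}"

definition commutator_prob :: "('a, 'b) monoid_scheme \<Rightarrow> 'a \<Rightarrow> real" where
  "commutator_prob G g =
     real (card {(x, y). x \<in> carrier G \<and> y \<in> carrier G \<and> commutator G x y = g})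
       / (real (order G))\<^sup>2"

definition commutator_probs :: "('a, 'b) monoid_scheme \<Rightarrow> real set" where
  "commutator_probs G = {commutator_prob G g | g. g \<in> commutator_set G \<and> g \<noteq> \<one>\<^bsub>G\<^esub>}"

definition conj_class :: "('a, 'b) monoid_scheme \<Rightarrow> 'a \<Rightarrow> 'a set" where
  "conj_class G x = {inv\<^bsub>G\<^esub> g \<otimes>\<^bsub>G\<^esub> x \<otimes>\<^bsub>G\<^esub> g | g. g \<in> carrier G}"

text \<open>
  The library's \<^const>\<open>derived\<close> is generated by the commutators
  \<open>x \<otimes> y \<otimes> inv x \<otimes> inv y\<close>. Replacing \<open>x\<close> and \<open>y\<close> by their inverses shows that the
  convention used here produces the same set, hence the same commutator subgroup.
\<close>

lemma (in group) derived_eq_generate_commutator_set: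
  "derived G (carrier G) = generate G (commutator_set G)"
proof -
  have "derived_set G (carrier G) = commutator_set G"
  proof (intro equalityI subsetI)
    fix z assume "z \<in> derived_set G (carrier G)"
    then obtain x y where xy: "x \<in> carrier G" "y \<in> carrier G"
      and z: "z = x \<otimes> y \<otimes> inv x \<otimes> inv y"
      by blast
    have "z = commutator G (inv x) (inv y)"
      using xy z by (simp add: commutator_def)
    then show "z \<in> commutator_set G"
      unfolding commutator_set_def using xy inv_closed by blast
  next
    fix z assume "z \<in> commutator_set G"
    then obtain x y where xy: "x \<in> carrier G" "y \<in> carrier G" and z: "z = commutator G x y"
      unfolding commutator_set_def by blast
    have "z = inv x \<otimes> inv y \<otimes> inv (inv x) \<otimes> inv (inv y)"
      using xy z by (simp add: commutator_def)
    then show "z \<in> derived_set G (carrier G)"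
      using xy inv_closed by blast
  qed
  then show ?thesis
    by (simp add: derived_def)
qed

definition camina_group :: "('a, 'b) monoid_scheme \<Rightarrow> bool" where
  "camina_group G \<longleftrightarrow> group G \<and> finite (carrier G) \<and>
     (\<forall>x \<in> carrier G - derived G (carrier G).
        conj_class G x = x <#\<^bsub>G\<^esub> derived G (carrier G))"

end

theory Submission
  imports Defs "HOL-Number_Theory.Cong" "HOL-Algebra.Weak_Morphisms"
begin

text \<open>
  Take the group with carrier \<open>V \<times> \<Lambda>\<^sup>2 V\<close>, \<open>V = F\<^sub>p\<^sup>n\<close>, \<open>n = r + 1\<close>, in which the commutator of
  two elements lying over \<open>u, v \<in> V\<close> is the bivector \<open>u \<and> v\<close>. If \<open>w = a \<and> b \<noteq> 0\<close>, then the pairs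
  \<open>(u, v)\<close> with \<open>u \<and> v = w\<close> are the bases of the plane spanned by \<open>a, b\<close> of a prescribed
  determinant, so there are \<open>(p\<^sup>2 - 1) p\<close> of them, whatever \<open>w\<close> is. The conjugacy class of an
  element over \<open>u\<close> moves it only by bivectors \<open>u \<and> v\<close>, which for \<open>n \<ge> 3\<close> miss some of \<open>\<Lambda>\<^sup>2 V\<close>.
\<close>

definition minor :: "('k \<Rightarrow> int) \<Rightarrow> ('k \<Rightarrow> int) \<Rightarrow> 'k \<Rightarrow> 'k \<Rightarrow> int" where
  "minor u v k l = u k * v l - u l * v k"

section \<open>Matrices of prescribed determinant modulo a prime\<close>

lemma prime_coprime_residue:
  assumes "prime (p :: nat)" "s \<in> {0..<int p}" "s \<noteq> 0"
  shows "coprime s (int p)"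
proof -
  have "\<not> int p dvd s"
    using assms zdvd_not_zless by fastforce
  then show ?thesis
    using prime_imp_coprime[of "int p" s] assms(1) by (simp add: coprime_commute)
qed

lemma residue_eqI:
  assumes "[s = t] (mod int p)" "s \<in> {0..<int p}" "t \<in> {0..<int p}"
  shows "s = t"
  using assms by (auto intro: cong_less_imp_eq_int)

text \<open>An inverse of \<open>s\<close> modulo \<open>p\<close> yields a solution, and cancelling
  \<open>s\<close> its uniqueness. The singleton form lets fibre cardinalities be read off.\<close>

lemma linear_cong_solution:
  assumes "p > 0" "coprime s (int p)"
  obtains z where "{x \<in> {0..<int p}. [s * x = c] (mod int p)} = {z}"
proof -
  obtain e where e: "[s * e = 1] (mod int p)"
    using cong_solve_coprime_int assms(2) by blast
  let ?z = "(e * c) mod int p"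
  have "[s * ?z = (s * e) * c] (mod int p)"
    by (simp add: cong_def mod_simps mult.assoc)
  also have "[(s * e) * c = 1 * c] (mod int p)"
    using e by (rule cong_scalar_right)
  finally have z: "[s * ?z = c] (mod int p)" by simp
  have "x = ?z" if "x \<in> {0..<int p}" "[s * x = c] (mod int p)" for x
  proof (rule residue_eqI)
    have "[s * x = s * ?z] (mod int p)"
      using that(2) z cong_trans cong_sym by blast
    then show "[x = ?z] (mod int p)"
      using cong_mult_lcancel[OF assms(2)] by blast
  qed (use that assms in auto)
  then have "{x \<in> {0..<int p}. [s * x = c] (mod int p)} = {?z}"
    using z assms(1) by auto
  then show ?thesis by (rule that)
qed

text \<open>With the nonzero row \<open>(s, t)\<close> fixed, the determinant is a nonzero linear
  form in the other row: one entry is free, and the entry multiplied by a unit is then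
  determined.\<close>

lemma card_determinant_row:
  assumes p: "prime p" and st: "(s, t) \<in> {0..<int p} \<times> {0..<int p}" "(s, t) \<noteq> (0, 0)"
  shows "card {(s', t'). s' \<in> {0..<int p} \<and> t' \<in> {0..<int p} \<and> [s * t' - t * s' = D] (mod int p)} = p"
    (is "card ?A = p")
proof -
  have p0: "p > 0" using p prime_gt_0_nat by blast
  show ?thesis
  proof (cases "s = 0")
    case False
    then have cop: "coprime s (int p)"
      using prime_coprime_residue p st by auto
    have "?A = (SIGMA s' : {0..<int p}. {x \<in> {0..<int p}. [s * x = D + t * s'] (mod int p)})"
      by (auto simp: cong_iff_dvd_diff algebra_simps)
    moreover have "card {x \<in> {0..<int p}. [s * x = c] (mod int p)} = 1" for c
      by (rule linear_cong_solution[OF p0 cop, of c]) simp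
    ultimately show ?thesis
      using card_SigmaI[of "{0..<int p}" "\<lambda>s'. {x \<in> {0..<int p}. [s * x = D + t * s'] (mod int p)}"]
        finite_Collect_conjI[of "\<lambda>x. x \<in> {0..<int p}"]
      by simp
  next
    case True
    then have cop: "coprime t (int p)"
      using prime_coprime_residue p st by auto
    have "[- (t * x) = D] (mod int p) \<longleftrightarrow> [t * x = - D] (mod int p)" for x
      using cong_minus_minus_iff[of "t * x" "- D" "int p"] by simp
    then have "?A = {x \<in> {0..<int p}. [t * x = - D] (mod int p)} \<times> {0..<int p}"
      using True by auto
    moreover have "card {x \<in> {0..<int p}. [t * x = - D] (mod int p)} = 1"
      by (rule linear_cong_solution[OF p0 cop, of "- D"]) simp
    ultimately show ?thesis by (simp add: card_cartesian_product)
  qed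
qed

text \<open>Sum over first rows. The zero row has determinant 0, which is not congruent to the unit
  \<open>D\<close>; each of the other p^2 - 1 rows extends in \<open>p\<close> ways.\<close>

lemma card_determinant:
  assumes p: "prime p" and D: "coprime D (int p)"
  shows "card {((s, t), (s', t')). (s, t) \<in> {0..<int p} \<times> {0..<int p} \<and>
      (s', t') \<in> {0..<int p} \<times> {0..<int p} \<and> [s * t' - t * s' = D] (mod int p)} = (p\<^sup>2 - 1) * p"
    (is "card ?Q = _")
proof -
  let ?R = "{0..<int p} \<times> {0..<int p}"
  have p1: "p > 1" using p prime_gt_1_nat by blast
  have "(0, 0) \<in> ?R"
    using p1 by simp
  then have card_R: "card (?R - {(0, 0)}) = p\<^sup>2 - 1"
    by (simp only: card_Diff_singleton card_cartesian_product power2_eq_square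
        card_atLeastLessThan_int) simp
  have zero: "\<not> [0 = D] (mod int p)"
    using D p1 cong_0_iff[of D "int p"] coprime_common_divisor[of D "int p" "int p"]
    by (auto simp: cong_sym_eq[of 0])
  have fin_R: "finite (?R - {(0, 0)})"
    by simp
  have fin: "finite {(s', t'). s' \<in> {0..<int p} \<and> t' \<in> {0..<int p} \<and>
      [fst st * t' - snd st * s' = D] (mod int p)}" for st
    by (rule finite_subset[of _ ?R]) auto
  from zero have "?Q = (SIGMA st : ?R - {(0, 0)}.
      {(s', t'). s' \<in> {0..<int p} \<and> t' \<in> {0..<int p} \<and> [fst st * t' - snd st * s' = D] (mod int p)})"
    by auto
  then have "card ?Q = (\<Sum>st \<in> ?R - {(0, 0)}. card {(s', t'). s' \<in> {0..<int p} \<and> t' \<in> {0..<int p} \<and>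
      [fst st * t' - snd st * s' = D] (mod int p)})"
    using fin by (simp only: card_SigmaI[OF fin_R ballI])
  also have "\<dots> = (\<Sum>st \<in> ?R - {(0, 0)}. p)"
  proof (rule sum.cong[OF refl])
    fix st assume "st \<in> ?R - {(0, 0)}"
    then have "(fst st, snd st) \<in> ?R" "(fst st, snd st) \<noteq> (0, 0)"
      by (cases st; simp)+
    then show "card {(s', t'). s' \<in> {0..<int p} \<and> t' \<in> {0..<int p} \<and>
      [fst st * t' - snd st * s' = D] (mod int p)} = p"
      by (rule card_determinant_row[OF p])
  qed
  also have "\<dots> = (p\<^sup>2 - 1) * p"
    using card_R by simp
  finally show ?thesis .
qed

section \<open>Pairs of vectors with prescribed minors\<close>

text \<open>
  A pair \<open>(u, v)\<close> with the same minors as \<open>(a, b)\<close> is determined by its entries at the pivot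
  positions \<open>i, j\<close>: since \<open>u \<and> (u \<and> v) = 0\<close>, every \<open>u k\<close> is a combination of \<open>u i\<close> and \<open>u j\<close>.
  Conversely, the pairs defined by this formula have the right minors by the Pluecker relation
  \<open>w i k * w j l - w i l * w j k = w i j * w k l\<close>.
\<close>

lemma card_same_minors:
  assumes p: "prime p" and ij: "i \<in> K" "j \<in> K"
    and D: "coprime (minor a b i j) (int p)"
  shows "card {(u, v). u \<in> K \<rightarrow>\<^sub>E {0..<int p} \<and> v \<in> K \<rightarrow>\<^sub>E {0..<int p} \<and>
      (\<forall>k\<in>K. \<forall>l\<in>K. [minor u v k l = minor a b k l] (mod int p))} = (p\<^sup>2 - 1) * p"
    (is "card ?S = _")
proof -
  let ?w = "minor a b"
  let ?D = "?w i j"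
  let ?Q = "{((s, t), (s', t')). (s, t) \<in> {0..<int p} \<times> {0..<int p} \<and>
      (s', t') \<in> {0..<int p} \<times> {0..<int p} \<and> [s * t' - t * s' = ?D] (mod int p)}"
  let ?f = "\<lambda>(u, v). ((u i, u j), (v i, v j))"
  have p0: "p > 0" using p prime_gt_0_nat by blast
  obtain e where e: "[?D * e = 1] (mod int p)"
    using cong_solve_coprime_int D by blast
  have recover: "[?D * u k = u j * ?w i k - u i * ?w j k] (mod int p)"
      "[?D * v k = v j * ?w i k - v i * ?w j k] (mod int p)"
    if "(u, v) \<in> ?S" "k \<in> K" for u v k
  proof -
    have m: "[minor u v i j = ?D] (mod int p)" "[minor u v i k = ?w i k] (mod int p)"
      "[minor u v j k = ?w j k] (mod int p)"
      using that ij by auto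
    \<comment> \<open>The identity \<open>*\<close> expresses the vanishing of the 3 x 3 determinant
      with rows \<open>x\<close>, \<open>u\<close>, \<open>v\<close> and columns \<open>i\<close>,
      \<open>j\<close>, \<open>k\<close>, two rows being equal when \<open>x\<close> is
      \<open>u\<close> or \<open>v\<close>.\<close>
    have cong_u: "[?D * x k = x j * ?w i k - x i * ?w j k] (mod int p)"
      if *: "minor u v i j * x k = x j * minor u v i k - x i * minor u v j k" for x
    proof -
      have "[?D * x k = minor u v i j * x k] (mod int p)"
        by (intro cong_scalar_right cong_sym[OF m(1)])
      also have "[minor u v i j * x k = x j * ?w i k - x i * ?w j k] (mod int p)"
        unfolding * by (intro cong_diff cong_scalar_left m)
      finally show ?thesis .
    qed
    show "[?D * u k = u j * ?w i k - u i * ?w j k] (mod int p)"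
        "[?D * v k = v j * ?w i k - v i * ?w j k] (mod int p)"
      by (rule cong_u; simp add: minor_def algebra_simps)+
  qed
  have "inj_on ?f ?S"
  proof (rule inj_onI)
    fix x y assume x: "x \<in> ?S" and y: "y \<in> ?S" and xy: "?f x = ?f y"
    obtain u v u' v' where [simp]: "x = (u, v)" "y = (u', v')"
      by (cases x, cases y) auto
    have uv: "(u, v) \<in> ?S" "(u', v') \<in> ?S"
      and [simp]: "u' i = u i" "u' j = u j" "v' i = v i" "v' j = v j"
      using x y xy by simp_all
    have "[u k = u' k] (mod int p)" "[v k = v' k] (mod int p)" if "k \<in> K" for k
      using cong_trans[OF recover(1)[OF uv(1) that], of "?D * u' k"] cong_sym[OF recover(1)[OF uv(2) that]]
        cong_trans[OF recover(2)[OF uv(1) that], of "?D * v' k"] cong_sym[OF recover(2)[OF uv(2) that]]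
        cong_mult_lcancel[OF D]
      by auto
    then have "u = u'" "v = v'"
      using x y by (auto intro!: PiE_ext[of _ K "\<lambda>_. {0..<int p}"] residue_eqI[of _ _ p])
    then show "x = y" by simp
  qed
  moreover have "?f ` ?S = ?Q"
  proof (intro equalityI subsetI)
    fix q assume "q \<in> ?f ` ?S"
    then show "q \<in> ?Q"
      using ij by (auto simp: minor_def PiE_iff)
  next
    fix q assume q: "q \<in> ?Q"
    obtain s t s' t' where [simp]: "q = ((s, t), (s', t'))"
      by (cases q) auto
    have st: "[s * t' - t * s' = ?D] (mod int p)"
      using q by simp
    \<comment> \<open>\<open>c s t\<close> solves the congruences of \<open>recover\<close> for a
      vector with entries \<open>s\<close> at \<open>i\<close> and \<open>t\<close> at
      \<open>j\<close>; \<open>e\<close> inverts \<open>?D\<close>, and the reduction picks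
      representatives in range.\<close>
    define c where "c = (\<lambda>s t. \<lambda>k\<in>K. (e * (t * ?w i k - s * ?w j k)) mod int p)"
    have c: "c s t \<in> K \<rightarrow>\<^sub>E {0..<int p}" for s t
      using p0 by (auto simp: c_def)
    have ck: "[c s t k = e * (t * ?w i k - s * ?w j k)] (mod int p)" if "k \<in> K" for s t k
      using that by (simp add: c_def)
    have "[minor (c s t) (c s' t') k l = ?w k l] (mod int p)" if "k \<in> K" "l \<in> K" for k l
    proof -
      have "[minor (c s t) (c s' t') k l = 
          (e * (t * ?w i k - s * ?w j k)) * (e * (t' * ?w i l - s' * ?w j l)) -
          (e * (t * ?w i l - s * ?w j l)) * (e * (t' * ?w i k - s' * ?w j k))] (mod int p)"
        unfolding minor_def[of "c s t"] by (intro cong_diff cong_mult ck that)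
      \<comment> \<open>The left side is \<open>(s * t' - t * s') * e * e\<close> times
        \<open>?w i k * ?w j l - ?w i l * ?w j k\<close>, and the Pluecker relation turns the last
        factor into \<open>?D * ?w k l\<close>.\<close>
      also have "(e * (t * ?w i k - s * ?w j k)) * (e * (t' * ?w i l - s' * ?w j l)) -
          (e * (t * ?w i l - s * ?w j l)) * (e * (t' * ?w i k - s' * ?w j k)) =
          (s * t' - t * s') * (?D * e) * e * ?w k l"
        by (simp add: minor_def algebra_simps)
      also have "[(s * t' - t * s') * (?D * e) * e * ?w k l = ?D * 1 * e * ?w k l] (mod int p)"
        by (intro cong_mult st e cong_refl)
      also have "[?D * 1 * e * ?w k l = 1 * ?w k l] (mod int p)"
        using cong_scalar_right[OF e] by simp
      finally show ?thesis by simp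
    qed
    then have "(c s t, c s' t') \<in> ?S"
      using c by simp
    \<comment> \<open>Since \<open>?w\<close> is alternating, the expression defining
      \<open>c s t\<close> collapses to \<open>e * ?D * s\<close> at \<open>i\<close> and to
      \<open>e * ?D * t\<close> at \<open>j\<close>.\<close>
    moreover have "c s t i = s" "c s t j = t"
      if "s \<in> {0..<int p}" "t \<in> {0..<int p}" for s t
    proof -
      have "[e * (t * ?w i i - s * ?w j i) = s] (mod int p)"
        "[e * (t * ?w i j - s * ?w j j) = t] (mod int p)"
        using cong_scalar_right[OF e, of s] cong_scalar_right[OF e, of t]
        by (simp_all add: minor_def algebra_simps)
      then show "c s t i = s" "c s t j = t"
        using ck[of i s t] ck[of j s t] that c[of s t] ij
        by (meson PiE_mem cong_trans residue_eqI)+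
    qed
    ultimately show "q \<in> ?f ` ?S"
      using q by (intro image_eqI[of _ _ "(c s t, c s' t')"]) auto
  qed
  ultimately have "card ?S = card ?Q"
    using card_image[of ?f ?S] by (simp only:)
  then show ?thesis
    using card_determinant[OF p D] by simp
qed

section \<open>Commutators and their invariance under isomorphism\<close>

lemma (in group_hom) hom_commutator:
  assumes "x \<in> carrier G" "y \<in> carrier G"
  shows "h (commutator G x y) = commutator H (h x) (h y)"
  using assms by (simp add: commutator_def)

lemma (in group) commutator_closed:
  assumes "x \<in> carrier G" "y \<in> carrier G"
  shows "commutator G x y \<in> carrier G"
  using assms by (simp add: commutator_def)

text \<open>Exhibits the conjugacy class of \<open>x\<close> as \<open>x\<close> times the
  commutators of \<open>x\<close> with all \<open>g\<close>, which is how it is compared with a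
  coset of the derived subgroup.\<close>

lemma (in group) conj_eq_mult_commutator:
  assumes "x \<in> carrier G" "g \<in> carrier G"
  shows "inv g \<otimes> x \<otimes> g = x \<otimes> commutator G x g"
  using assms by (simp add: commutator_def flip: m_assoc)

text \<open>Lets a commutator be verified by multiplication alone, without a formula for
  inverses.\<close>

lemma (in group) commutator_eqI:
  assumes "x \<in> carrier G" "y \<in> carrier G" "z \<in> carrier G" "x \<otimes> y = y \<otimes> x \<otimes> z"
  shows "commutator G x y = z"
proof -
  have "commutator G x y = inv (y \<otimes> x) \<otimes> (x \<otimes> y)"
    using assms(1,2) by (simp add: commutator_def inv_mult_group m_assoc)
  also have "\<dots> = inv (y \<otimes> x) \<otimes> (y \<otimes> x) \<otimes> z"
    unfolding assms(4) using assms(1-3) by (subst m_assoc[symmetric]) auto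
  finally show ?thesis
    using assms(1-3) by simp
qed

lemma commutator_in_commutator_set:
  "x \<in> carrier G \<Longrightarrow> y \<in> carrier G \<Longrightarrow> commutator G x y \<in> commutator_set G"
  by (auto simp: commutator_set_def)

lemma (in group_hom) image_commutator_set:
  assumes "h ` carrier G = carrier H"
  shows "commutator_set H = h ` commutator_set G"
proof (intro equalityI subsetI)
  fix z assume "z \<in> commutator_set H"
  then obtain x y where "x \<in> carrier G" "y \<in> carrier G" "z = commutator H (h x) (h y)"
    by (auto simp: commutator_set_def simp flip: assms)
  then show "z \<in> h ` commutator_set G"
    by (simp add: commutator_in_commutator_set flip: hom_commutator)
next
  fix z assume "z \<in> h ` commutator_set G"
  then obtain x y where "x \<in> carrier G" "y \<in> carrier G" "z = h (commutator G x y)"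
    by (auto simp: commutator_set_def)
  then show "z \<in> commutator_set H"
    by (simp add: hom_commutator commutator_in_commutator_set)
qed

lemma (in group_hom) iso_commutator_prob:
  assumes h: "bij_betw h (carrier G) (carrier H)" and g: "g \<in> carrier G"
  shows "commutator_prob H (h g) = commutator_prob G g"
proof -
  have inj: "inj_on h (carrier G)" and im: "carrier H = h ` carrier G"
    using h by (auto simp: bij_betw_def)
  let ?C = "\<lambda>K g. {(x, y). x \<in> carrier K \<and> y \<in> carrier K \<and> commutator K x y = g}"
  have "?C H (h g) = map_prod h h ` ?C G g"
    using inj_onD[OF inj _ G.commutator_closed g]
    by (auto simp: im map_prod_def image_iff simp flip: hom_commutator)
  moreover have "inj_on (map_prod h h) (?C G g)"
    using inj by (auto simp: inj_on_def)
  moreover have "order H = order G"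
    using h by (simp add: order_def bij_betw_same_card)
  ultimately show ?thesis
    by (simp add: commutator_prob_def card_image)
qed

text \<open>An isomorphism carries derived subgroup, conjugacy classes and cosets of
  \<open>G\<close> to those of \<open>H\<close>. The contrapositive transfers the failure of the
  Camina condition from \<open>G\<close> to \<open>H\<close>.\<close>

lemma (in group_hom) iso_camina_group:
  assumes h: "bij_betw h (carrier G) (carrier H)" and H: "camina_group H"
  shows "camina_group G"
proof -
  have inj: "inj_on h (carrier G)" and im: "h ` carrier G = carrier H"
    using h by (auto simp: bij_betw_def)
  let ?G' = "derived G (carrier G)"
  have sub: "?G' \<subseteq> carrier G"
    by (rule G.derived_in_carrier) simp
  have der: "derived H (carrier H) = h ` ?G'"
    using derived_img[of "carrier G"] im by simp
  have "conj_class G x = x <# ?G'" if x: "x \<in> carrier G - ?G'" for x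
  proof -
    have "h x \<in> carrier H - h ` ?G'"
      using x inj sub by (auto dest: inj_onD)
    then have "conj_class H (h x) = h x <#\<^bsub>H\<^esub> h ` ?G'"
      using H by (simp add: camina_group_def der)
    moreover have "conj_class H (h x) = h ` conj_class G x"
      using x by (simp add: conj_class_def Setcompr_eq_image image_image flip: im cong: image_cong)
    moreover have "h x <#\<^bsub>H\<^esub> h ` ?G' = h ` (x <# ?G')"
      using x sub by (auto simp: l_coset_def image_iff) (metis hom_mult subsetD)+
    ultimately have "h ` conj_class G x = h ` (x <# ?G')" by simp
    then show ?thesis
      by (rule inj_on_image_eq_iff[OF inj, THEN iffD1, rotated 2])
        (use x sub in \<open>auto simp: conj_class_def l_coset_def\<close>)
  qed
  moreover have "finite (carrier G)"
    using H inj im by (metis camina_group_def finite_imageD)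
  ultimately show ?thesis
    using G.is_group by (simp add: camina_group_def)
qed

section \<open>The group of vectors and bivectors\<close>

definition index_pairs :: "nat \<Rightarrow> (nat \<times> nat) set" where
  "index_pairs n = {(k, l). k < l \<and> l < n}"

lemma finite_index_pairs [simp]: "finite (index_pairs n)"
  by (rule finite_subset[of _ "{..<n} \<times> {..<n}"]) (auto simp: index_pairs_def)

text \<open>The dimension of \<open>V \<times> \<Lambda>\<^sup>2 V\<close>, which is the exponent of
  \<open>p\<close> in the group order.\<close>

lemma card_index_pairs: "n + card (index_pairs n) = n * (n + 1) div 2"
proof (induction n)
  case (Suc n)
  have "index_pairs (Suc n) = index_pairs n \<union> {..<n} \<times> {n}"
    by (auto simp: index_pairs_def less_Suc_eq)
  moreover have "index_pairs n \<inter> {..<n} \<times> {n} = {}"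
    by (auto simp: index_pairs_def)
  ultimately have "card (index_pairs (Suc n)) = card (index_pairs n) + n"
    by (simp add: card_Un_disjoint card_cartesian_product)
  then show ?case
    using Suc.IH by simp
qed (simp add: index_pairs_def)

text \<open>Vectors over the field of \<open>p\<close> elements, with reduced residues as entries.
  Extensional functions make this set finite for a finite \<open>K\<close>, and make equality on
  \<open>K\<close> equality of functions.\<close>

definition vecs :: "nat \<Rightarrow> 'k set \<Rightarrow> ('k \<Rightarrow> int) set" where
  "vecs p K = K \<rightarrow>\<^sub>E {0..<int p}"

text \<open>
  A bivector is given by its coordinates at the pairs \<open>k < l\<close>. The cocycle \<open>u k * v l\<close> is used
  instead of half of the alternating form, in order to cover \<open>p = 2\<close>.
\<close>

definition bivector_group :: "nat \<Rightarrow> nat \<Rightarrow> ((nat \<Rightarrow> int) \<times> (nat \<times> nat \<Rightarrow> int)) monoid" where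
  "bivector_group p n = \<lparr>carrier = vecs p {..<n} \<times> vecs p (index_pairs n),
     monoid.mult = \<lambda>(u, c) (v, d). (\<lambda>k\<in>{..<n}. (u k + v k) mod int p,
       \<lambda>e\<in>index_pairs n. (c e + d e + u (fst e) * v (snd e)) mod int p),
     one = (\<lambda>k\<in>{..<n}. 0, \<lambda>e\<in>index_pairs n. 0)\<rparr>"

lemma vecs_eqI:
  assumes "u \<in> vecs p K" "v \<in> vecs p K" "\<And>k. k \<in> K \<Longrightarrow> u k = v k"
  shows "u = v"
  using assms unfolding vecs_def by (rule PiE_ext)

lemma vecs_mod [simp]: "u \<in> vecs p K \<Longrightarrow> k \<in> K \<Longrightarrow> u k mod int p = u k"
  by (auto simp: vecs_def PiE_iff)

lemma card_vecs: "finite K \<Longrightarrow> card (vecs p K) = p ^ card K"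
  by (simp add: vecs_def card_PiE)

text \<open>Removes the inner reductions from the bivector coordinates of \<open>(x y) z\<close> and
  of \<open>x (y z)\<close> respectively.\<close>

lemma mod_add_mult_eq:
  fixes a b c d m :: int
  shows "(a mod m + b + (c mod m) * d) mod m = (a + b + c * d) mod m"
    and "(a + b mod m + c * (d mod m)) mod m = (a + b + c * d) mod m"
  by (intro mod_add_cong mod_mult_cong; simp)+

context
  fixes p n :: nat
  assumes p: "prime p"
begin

abbreviation (input) "\<G> \<equiv> bivector_group p n"

lemma p_pos: "int p > 0"
  using prime_gt_0_nat[OF p] by simp

lemma restrict_vecs [simp]:
  "(\<lambda>k\<in>K. f k mod int p) \<in> vecs p K" "(\<lambda>k\<in>K. 0) \<in> vecs p K"
  using p_pos by (auto simp: vecs_def)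

lemma group_bivector_group: "group \<G>"
proof (rule groupI)
  fix x y z assume "x \<in> carrier \<G>" "y \<in> carrier \<G>" "z \<in> carrier \<G>"
  \<comment> \<open>For vector parts \<open>u\<close>, \<open>v\<close>, \<open>w\<close>, both
    bracketings contribute \<open>u k * v l + u k * w l + v k * w l\<close>, because the cocycle is
    bilinear.\<close>
  then show "x \<otimes>\<^bsub>\<G>\<^esub> y \<otimes>\<^bsub>\<G>\<^esub> z = x \<otimes>\<^bsub>\<G>\<^esub> (y \<otimes>\<^bsub>\<G>\<^esub> z)"
    by (auto simp: bivector_group_def index_pairs_def mod_add_mult_eq mod_simps intro!: restrict_ext)
      (simp_all add: algebra_simps)
next
  fix x assume x: "x \<in> carrier \<G>"
  obtain u c where [simp]: "x = (u, c)" by (cases x)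
  show "\<one>\<^bsub>\<G>\<^esub> \<otimes>\<^bsub>\<G>\<^esub> x = x"
    using x by (auto simp: bivector_group_def index_pairs_def intro!: vecs_eqI)
  \<comment> \<open>The cocycle of \<open>- u\<close> and \<open>u\<close> is
    \<open>- u k * u l\<close>; the extra product in the bivector part of the inverse compensates
    for it.\<close>
  have "(\<lambda>k\<in>{..<n}. (- u k) mod int p, \<lambda>e\<in>index_pairs n. (- c e + u (fst e) * u (snd e)) mod int p)
      \<otimes>\<^bsub>\<G>\<^esub> x = \<one>\<^bsub>\<G>\<^esub>"
    by (auto simp: bivector_group_def index_pairs_def mod_add_mult_eq mod_simps intro!: restrict_ext)
  then show "\<exists>y\<in>carrier \<G>. y \<otimes>\<^bsub>\<G>\<^esub> x = \<one>\<^bsub>\<G>\<^esub>"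
    by (rule bexI) (simp add: bivector_group_def)
qed (auto simp: bivector_group_def)

lemma order_bivector_group: "order \<G> = p ^ (n * (n + 1) div 2)"
  using card_index_pairs[of n]
  by (simp add: order_def bivector_group_def card_cartesian_product card_vecs flip: power_add)

text \<open>Exchanging the factors replaces the cocycle \<open>u k * v l\<close> by
  \<open>v k * u l\<close>, and the difference is the minor. Right multiplication by an element with
  zero vector part adds no cocycle term.\<close>

lemma commutator_bivector_group:
  assumes "(u, c) \<in> carrier \<G>" "(v, d) \<in> carrier \<G>"
  shows "commutator \<G> (u, c) (v, d) =
    (\<lambda>k\<in>{..<n}. 0, \<lambda>e\<in>index_pairs n. minor u v (fst e) (snd e) mod int p)"
  using assms(1,2)
proof (rule group.commutator_eqI[OF group_bivector_group])
  show "(\<lambda>k\<in>{..<n}. 0, \<lambda>e\<in>index_pairs n. minor u v (fst e) (snd e) mod int p) \<in> carrier \<G>"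
    by (simp add: bivector_group_def)
  show "(u, c) \<otimes>\<^bsub>\<G>\<^esub> (v, d) = (v, d) \<otimes>\<^bsub>\<G>\<^esub> (u, c) \<otimes>\<^bsub>\<G>\<^esub>
      (\<lambda>k\<in>{..<n}. 0, \<lambda>e\<in>index_pairs n. minor u v (fst e) (snd e) mod int p)"
    by (auto simp: bivector_group_def index_pairs_def minor_def mod_simps intro!: restrict_ext)
      (simp_all add: algebra_simps)
qed

text \<open>A commutator records the minors at \<open>k < l\<close> only; antisymmetry extends the
  congruences to all index pairs, as the count of pairs with equal minors requires.\<close>

lemma commutator_eq_iff_minors:
  assumes "(u, c) \<in> carrier \<G>" "(v, d) \<in> carrier \<G>" "(a, c') \<in> carrier \<G>" "(b, d') \<in> carrier \<G>"
  shows "commutator \<G> (u, c) (v, d) = commutator \<G> (a, c') (b, d') \<longleftrightarrow>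
    (\<forall>k\<in>{..<n}. \<forall>l\<in>{..<n}. [minor u v k l = minor a b k l] (mod int p))" (is "?L \<longleftrightarrow> ?R")
proof -
  have "?L \<longleftrightarrow> (\<forall>(k, l)\<in>index_pairs n. [minor u v k l = minor a b k l] (mod int p))"
    by (auto simp: commutator_bivector_group assms cong_def restrict_def fun_eq_iff)
  also have "\<dots> \<longleftrightarrow> ?R"
  proof (intro iffI ballI)
    fix k l assume *: "\<forall>(k, l)\<in>index_pairs n. [minor u v k l = minor a b k l] (mod int p)"
      and kl: "k \<in> {..<n}" "l \<in> {..<n}"
    have swap: "minor u v k l = - minor u v l k" "minor a b k l = - minor a b l k"
      by (simp_all add: minor_def)
    consider "k < l" | "k = l" | "l < k" by linarith
    then show "[minor u v k l = minor a b k l] (mod int p)"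
    proof cases
      case 3
      then show ?thesis
        using * kl unfolding swap cong_minus_minus_iff by (auto simp: index_pairs_def)
    qed (use * kl in \<open>auto simp: index_pairs_def minor_def\<close>)
  qed (auto simp: index_pairs_def)
  finally show ?thesis .
qed

text \<open>Having commutator \<open>g\<close> constrains only the two vector parts, in (p^2 - 1) p
  ways; the bivector parts are free, and their number squared cancels against the squared
  order.\<close>

lemma commutator_prob_bivector_group:
  assumes "g \<in> commutator_set \<G>" "g \<noteq> \<one>\<^bsub>\<G>\<^esub>"
  shows "commutator_prob \<G> g = (real p ^ 2 - 1) * real p / real p ^ (2 * n)"
proof -
  obtain a c b d where ab: "(a, c) \<in> carrier \<G>" "(b, d) \<in> carrier \<G>"
      and g: "g = commutator \<G> (a, c) (b, d)"
    using assms(1) by (auto simp: commutator_set_def)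
  \<comment> \<open>A nonzero coordinate of \<open>g\<close> supplies the pivot positions: its minor
    is a unit modulo \<open>p\<close>.\<close>
  obtain i j where ij: "i < n" "j < n" and "minor a b i j mod int p \<noteq> 0"
    using assms(2) unfolding g commutator_bivector_group[OF ab]
    by (auto simp: bivector_group_def index_pairs_def restrict_def fun_eq_iff split: if_splits)
      (meson less_trans)
  then have cop: "coprime (minor a b i j) (int p)"
    using prime_imp_coprime[of "int p" "minor a b i j"] p
    by (auto simp: coprime_commute dvd_eq_mod_eq_0)
  let ?S = "{(u, v). u \<in> vecs p {..<n} \<and> v \<in> vecs p {..<n} \<and>
      (\<forall>k\<in>{..<n}. \<forall>l\<in>{..<n}. [minor u v k l = minor a b k l] (mod int p))}"
  let ?Z = "vecs p (index_pairs n)"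
  let ?C = "{(x, y). x \<in> carrier \<G> \<and> y \<in> carrier \<G> \<and> commutator \<G> x y = g}"
  let ?f = "\<lambda>((u, v), (c, d)). ((u, c), (v, d))"
  have carrier: "x \<in> carrier \<G> \<longleftrightarrow> fst x \<in> vecs p {..<n} \<and> snd x \<in> ?Z" for x
    by (cases x) (simp add: bivector_group_def)
  have "?C = ?f ` (?S \<times> (?Z \<times> ?Z))"
  proof (intro equalityI subsetI)
    fix q assume q: "q \<in> ?C"
    obtain u c' v d' where [simp]: "q = ((u, c'), (v, d'))"
      by (metis surj_pair)
    have "((u, v), (c', d')) \<in> ?S \<times> (?Z \<times> ?Z)"
      using q commutator_eq_iff_minors[OF _ _ ab, of u c' v d'] by (simp add: carrier g)
    then show "q \<in> ?f ` (?S \<times> (?Z \<times> ?Z))"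
      by (rule rev_image_eqI) simp
  next
    fix q assume "q \<in> ?f ` (?S \<times> (?Z \<times> ?Z))"
    then obtain u v c' d' where "q = ((u, c'), (v, d'))" "(u, v) \<in> ?S" "c' \<in> ?Z" "d' \<in> ?Z"
      by auto
    then show "q \<in> ?C"
      using commutator_eq_iff_minors[OF _ _ ab, of u c' v d'] by (simp add: carrier g)
  qed
  moreover have "inj_on ?f (?S \<times> (?Z \<times> ?Z))"
    by (auto simp: inj_on_def)
  ultimately have "card ?C = card ?S * (card ?Z * card ?Z)"
    by (simp only: card_image card_cartesian_product)
  also have "card ?S = (p\<^sup>2 - 1) * p"
    unfolding vecs_def using card_same_minors[OF p _ _ cop] ij by simp
  finally have "real (card ?C) = (real p ^ 2 - 1) * real p * (real (card ?Z))\<^sup>2"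
    using prime_gt_0_nat[OF p] by (simp add: of_nat_diff power2_eq_square)
  moreover have "real (order \<G>) = real p ^ n * real (card ?Z)"
    by (simp add: order_def bivector_group_def card_cartesian_product card_vecs)
  moreover have "real (card ?Z) \<noteq> 0"
    using prime_gt_0_nat[OF p] by (simp add: card_vecs)
  ultimately show ?thesis
    unfolding commutator_prob_def
    by (simp only: power_mult_distrib) (simp add: power_mult mult.commute[of 2])
qed

section \<open>Basis vectors and the failure of the Camina condition\<close>

definition basis_vec :: "nat \<Rightarrow> (nat \<Rightarrow> int) \<times> (nat \<times> nat \<Rightarrow> int)" where
  "basis_vec i = (\<lambda>k\<in>{..<n}. if k = i then 1 else 0, \<lambda>e\<in>index_pairs n. 0)"

lemma basis_vec_carrier: "basis_vec i \<in> carrier \<G>"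
  using prime_gt_1_nat[OF p] by (auto simp: basis_vec_def bivector_group_def vecs_def)

text \<open>Serves twice: it gives a nontrivial commutator, and it shows that the bivector used
  against the Camina condition is nonzero at \<open>(1, 2)\<close>.\<close>

lemma commutator_basis_vec:
  assumes "i < j" "j < n"
  shows "snd (commutator \<G> (basis_vec i) (basis_vec j)) (i, j) = 1"
proof -
  have "snd (commutator \<G> (basis_vec i) (basis_vec j)) (i, j) = 1 mod int p"
    using assms basis_vec_carrier[of i] basis_vec_carrier[of j]
    by (simp add: basis_vec_def commutator_bivector_group index_pairs_def minor_def)
  then show ?thesis
    using prime_gt_1_nat[OF p] by simp
qed

lemma derived_bivector_group_fst:
  assumes "x \<in> derived \<G> (carrier \<G>)" "k < n"
  shows "fst x k = 0"
proof -
  interpret group \<G> by (rule group_bivector_group)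
  have comm: "fst x k = 0" if "x \<in> commutator_set \<G>" for x
    using that assms(2) by (auto simp: commutator_set_def commutator_bivector_group)
  have "x \<in> generate \<G> (commutator_set \<G>)"
    using assms(1) derived_eq_generate_commutator_set by simp
  then show ?thesis
  proof (induction rule: generate.induct)
    case one
    then show ?case using assms(2) by (simp add: bivector_group_def)
  next
    case (incl h)
    then show ?case by (rule comm)
  next
    \<comment> \<open>The inverse of a commutator is the commutator of the exchanged arguments, so
      the case reduces to \<open>comm\<close>.\<close>
    case (inv h)
    then obtain y z where yz: "y \<in> carrier \<G>" "z \<in> carrier \<G>" "h = commutator \<G> y z"
      by (auto simp: commutator_set_def)
    then have "inv\<^bsub>\<G>\<^esub> h = commutator \<G> z y"
      by (simp add: commutator_def inv_mult_group m_assoc)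
    then show ?case
      using yz by (intro comm) (simp add: commutator_in_commutator_set)
  next
    case (eng h1 h2)
    moreover obtain u c v d where "h1 = (u, c)" "h2 = (v, d)"
      by (metis surj_pair)
    ultimately show ?case
      using assms(2) by (simp add: bivector_group_def)
  qed
qed

text \<open>The Camina condition at \<open>basis_vec 0\<close> would make the commutator of
  \<open>basis_vec 1\<close> and \<open>basis_vec 2\<close> equal to one of
  \<open>basis_vec 0\<close> with some \<open>g\<close>. The latter vanishes at
  \<open>(1, 2)\<close>, as \<open>basis_vec 0\<close> is zero in both positions.\<close>

lemma not_camina_bivector_group:
  assumes "n \<ge> 3"
  shows "\<not> camina_group \<G>"
proof
  assume camina: "camina_group \<G>"
  interpret group \<G> by (rule group_bivector_group)
  let ?z = "commutator \<G> (basis_vec 1) (basis_vec 2)"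
  have "?z \<in> derived \<G> (carrier \<G>)"
    unfolding derived_eq_generate_commutator_set
    by (intro generate.incl commutator_in_commutator_set basis_vec_carrier)
  then have "basis_vec 0 \<otimes>\<^bsub>\<G>\<^esub> ?z \<in> basis_vec 0 <#\<^bsub>\<G>\<^esub> derived \<G> (carrier \<G>)"
    by (auto simp: l_coset_def)
  moreover have "basis_vec 0 \<notin> derived \<G> (carrier \<G>)"
    using derived_bivector_group_fst[of "basis_vec 0" 0] assms by (auto simp: basis_vec_def)
  ultimately have "basis_vec 0 \<otimes>\<^bsub>\<G>\<^esub> ?z \<in> conj_class \<G> (basis_vec 0)"
    using camina basis_vec_carrier by (simp add: camina_group_def)
  then obtain g where g: "g \<in> carrier \<G>"
      and eq: "basis_vec 0 \<otimes>\<^bsub>\<G>\<^esub> ?z = inv\<^bsub>\<G>\<^esub> g \<otimes>\<^bsub>\<G>\<^esub> basis_vec 0 \<otimes>\<^bsub>\<G>\<^esub> g"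
    by (auto simp: conj_class_def)
  have "inv\<^bsub>\<G>\<^esub> g \<otimes>\<^bsub>\<G>\<^esub> basis_vec 0 \<otimes>\<^bsub>\<G>\<^esub> g = basis_vec 0 \<otimes>\<^bsub>\<G>\<^esub> commutator \<G> (basis_vec 0) g"
    using basis_vec_carrier g by (rule conj_eq_mult_commutator)
  then have "?z = commutator \<G> (basis_vec 0) g"
    using eq g basis_vec_carrier commutator_closed by simp
  moreover have "snd (commutator \<G> (basis_vec 0) g) (1, 2) = 0"
    using g basis_vec_carrier[of 0] assms
    by (cases g) (simp add: basis_vec_def commutator_bivector_group index_pairs_def minor_def)
  ultimately show False
    using commutator_basis_vec[of 1 2] assms by simp
qed

end

section \<open>Transport to a carrier of natural numbers\<close>

theorem theoremB:
  fixes p r :: nat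
  assumes "prime p" and "r \<ge> 1"
  shows "\<exists>G :: nat monoid. group G \<and> finite (carrier G) \<and>
           order G = p ^ ((r + 1) * (r + 2) div 2) \<and>
           card (commutator_probs G) = 1 \<and>
           (\<forall>g \<in> commutator_set G. g \<noteq> \<one>\<^bsub>G\<^esub> \<longrightarrow>
              commutator_prob G g = (real p ^ 2 - 1) / real p ^ (2 * r + 1)) \<and>
           (r > 1 \<longrightarrow> \<not> camina_group G)"
proof -
  \<comment> \<open>With n = r + 1 the value (p^2 - 1) p / p^(2n) becomes \<open>?q\<close>, and
    \<open>r > 1\<close> becomes n >= 3.\<close>
  let ?H = "bivector_group p (r + 1)"
  let ?q = "(real p ^ 2 - 1) / real p ^ (2 * r + 1)"
  have ord: "order ?H = p ^ ((r + 1) * (r + 2) div 2)"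
    using order_bivector_group[OF assms(1), of "r + 1"] by simp
  have p0: "p > 0" using assms(1) prime_gt_0_nat by blast
  \<comment> \<open>An infinite carrier would have \<open>order\<close> 0, whereas a power of
    \<open>p\<close> is positive.\<close>
  then have fin: "finite (carrier ?H)"
    using ord by (metis card.infinite order_def power_not_zero not_gr_zero)
  then obtain f :: "_ \<Rightarrow> nat" where f: "inj_on f (carrier ?H)"
    using finite_imp_inj_to_nat_seg by metis
  define G where "G = image_group f ?H"
  have groupH: "group ?H"
    using assms(1) by (rule group_bivector_group)
  have groupG: "group G"
    unfolding G_def using groupH f by (rule group.inj_imp_image_group_is_group)
  have iso: "f \<in> iso ?H G"
    unfolding G_def using f by (rule inj_imp_image_group_iso)
  interpret group_hom ?H G f
    using groupH groupG iso by (simp add: group_hom_def group_hom_axioms_def iso_def)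
  have bij: "bij_betw f (carrier ?H) (carrier G)"
    using iso by (simp add: iso_def)
  have comm: "commutator_set G = f ` commutator_set ?H"
    using bij by (intro image_commutator_set) (simp add: bij_betw_def)
  have prob: "commutator_prob G g = ?q" if g: "g \<in> commutator_set G" "g \<noteq> \<one>\<^bsub>G\<^esub>" for g
  proof -
    obtain h where h: "h \<in> commutator_set ?H" "g = f h"
      using g comm by blast
    moreover have "h \<in> carrier ?H"
      using h G.commutator_closed by (auto simp: commutator_set_def)
    moreover have "h \<noteq> \<one>\<^bsub>?H\<^esub>"
      using g(2) h(2) hom_one by metis
    ultimately show ?thesis
      using iso_commutator_prob[OF bij, of h] commutator_prob_bivector_group[OF assms(1), of h "r + 1"] p0
      by simp
  qed
  \<comment> \<open>Without a nontrivial commutator the set of probabilities would be empty;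
    \<open>r \<ge> 1\<close> provides the two basis vectors with indices 0 and 1.\<close>
  have "\<exists>g\<in>commutator_set G. g \<noteq> \<one>\<^bsub>G\<^esub>"
  proof -
    let ?z = "commutator ?H (basis_vec (r + 1) 0) (basis_vec (r + 1) 1)"
    have "snd ?z (0, 1) \<noteq> snd \<one>\<^bsub>?H\<^esub> (0, 1)"
      using commutator_basis_vec[OF assms(1), of 0 1 "r + 1"] assms(2)
      by (simp add: bivector_group_def index_pairs_def)
    then have "?z \<noteq> \<one>\<^bsub>?H\<^esub>" by metis
    moreover have "?z \<in> carrier ?H"
      by (intro G.commutator_closed basis_vec_carrier[OF assms(1)])
    ultimately have "f ?z \<noteq> \<one>\<^bsub>G\<^esub>"
      using f by (metis G.one_closed hom_one inj_onD)
    moreover have "f ?z \<in> commutator_set G"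
      unfolding comm by (intro imageI commutator_in_commutator_set basis_vec_carrier[OF assms(1)])
    ultimately show ?thesis by blast
  qed
  then have "commutator_probs G = {?q}"
    using prob by (auto simp: commutator_probs_def) metis
  moreover have "order G = order ?H"
    using bij by (simp add: order_def bij_betw_same_card)
  moreover have "finite (carrier G)"
    using fin bij bij_betw_finite by blast
  moreover have "\<not> camina_group G" if "r > 1"
    using iso_camina_group[OF bij] not_camina_bivector_group[OF assms(1), of "r + 1"] that by auto
  ultimately show ?thesis
    using groupG ord prob by (intro exI[of _ G]) simp
qed

end
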